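(* Let $p \ge 5$ be a prime and let $n := 2^{p-1}$. The number $2^p-1$ is prime if and only if $$2n-1 \ \Big|\ \sum_{\substack{k=0\\ k \text{ even}}}^{\lfloor n/2\rfloor} (-1)^{\lfloor k/2\rfloor}\, \frac{\prod_{\lambda=0}^{\lfloor k/2\rfloor-1}\left[n^2-(4\lambda)^2\right]}{k!}.$$
   Context: The empty product (which occurs for $k=0$) equals $1$. Each summand is an integer, and the divisibility is divisibility of integers; note $2n-1 = 2^p-1$. *)

theory Defs
  imports Complex_Main "HOL-Computational_Algebra.Primes"
begin

end

theory Submission
  imports Defs "HOL-Number_Theory.Number_Theory"
begin

text \<open>With \<open>n = 4 * m\<close>, the sum is the power sum expansion of the Chebyshev polynomial \<open>T\<^sub>m\<close>
  about 1, evaluated at -7, as the three-term recurrence shows. Since \<open>m = 2 ^ (p - 3)\<close>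
  is even and \<open>T\<^sub>2 2 = 7\<close>, this value is \<open>T\<^sub>2\<^sub>m 2\<close>, the rational part of \<open>(2 + \<surd>3) ^ (2 ^ (p - 2))\<close>,
  which is half of the term that the Lucas--Lehmer test examines. The test itself is proved in the
  integers extended by \<open>\<surd>3\<close>. If \<open>M = 2 ^ p - 1\<close> divides the rational part, then \<open>2 + \<surd>3\<close> has
  order \<open>2 ^ p\<close> modulo every prime factor \<open>q\<close> of \<open>M\<close>, whereas there are only \<open>q\<^sup>2 - 1\<close> nonzero
  residues, so \<open>q\<^sup>2 > M\<close>. If \<open>M\<close> is prime, the Frobenius map applied to \<open>1 + \<surd>3\<close> gives
  \<open>(2 + \<surd>3) ^ (2 ^ (p - 1)) = -1\<close> modulo \<open>M\<close>.\<close>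

section \<open>The integers with the square root of 3 adjoined\<close>

text \<open>Although nothing here is recursive, a codatatype allows \<open>primcorec\<close> to
  specify each ring operation by its two coordinates.\<close>

codatatype zsqrt3 = Zsqrt3 (rat_part: int) (root_part: int)

lemma zsqrt3_eqI: "rat_part x = rat_part y \<Longrightarrow> root_part x = root_part y \<Longrightarrow> x = y"
  by (rule zsqrt3.expand) simp

instantiation zsqrt3 :: comm_ring_1
begin

primcorec zero_zsqrt3 where
  "rat_part 0 = 0"
| "root_part 0 = 0"

primcorec one_zsqrt3 where
  "rat_part 1 = 1"
| "root_part 1 = 0"

primcorec plus_zsqrt3 where
  "rat_part (x + y) = rat_part x + rat_part y"
| "root_part (x + y) = root_part x + root_part y"

primcorec uminus_zsqrt3 where
  "rat_part (- x) = - rat_part x"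
| "root_part (- x) = - root_part x"

primcorec minus_zsqrt3 where
  "rat_part (x - y) = rat_part x - rat_part y"
| "root_part (x - y) = root_part x - root_part y"

primcorec times_zsqrt3 where
  "rat_part (x * y) = rat_part x * rat_part y + 3 * root_part x * root_part y"
| "root_part (x * y) = rat_part x * root_part y + root_part x * rat_part y"

instance
  by standard (auto intro!: zsqrt3_eqI simp: algebra_simps dest: arg_cong[where f = rat_part])

end

lemma parts_of_nat [simp]: "rat_part (of_nat k) = int k" "root_part (of_nat k) = 0"
  by (induction k) auto

lemma parts_of_int [simp]: "rat_part (of_int k) = k" "root_part (of_int k) = 0"
  by (cases k; simp)+

lemma parts_numeral [simp]: "rat_part (numeral k) = numeral k" "root_part (numeral k) = 0"
  using parts_of_int[of "numeral k"] by simp_all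

lemma of_int_dvd_zsqrt3_iff:
  "of_int c dvd x \<longleftrightarrow> c dvd rat_part x \<and> c dvd root_part x"
proof
  assume "c dvd rat_part x \<and> c dvd root_part x"
  then obtain k l where "rat_part x = c * k" "root_part x = c * l"
    by (auto elim!: dvdE)
  then have "x = of_int c * Zsqrt3 k l"
    by (intro zsqrt3_eqI) auto
  then show "of_int c dvd x" ..
qed auto

abbreviation root3 :: zsqrt3 where "root3 \<equiv> Zsqrt3 0 1"

abbreviation unit3 :: zsqrt3 where "unit3 \<equiv> Zsqrt3 2 1"

lemma root3_square: "root3\<^sup>2 = 3"
  by (rule zsqrt3_eqI) (simp_all add: power2_eq_square)

lemma unit3_norm: "unit3 * Zsqrt3 2 (- 1) = 1"
  by (rule zsqrt3_eqI) simp_all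

text \<open>The norm is multiplicative and equals 1 at \<open>unit3\<close>. This eliminates the
  root part in the doubling formula and shows that the two parts of a power are coprime.\<close>

lemma norm_unit3_power: "(rat_part (unit3 ^ k))\<^sup>2 - 3 * (root_part (unit3 ^ k))\<^sup>2 = 1"
  by (induction k) (simp_all add: power2_eq_square algebra_simps)

lemma parts_unit3_power_double:
  "rat_part (unit3 ^ (2 * k)) = 2 * (rat_part (unit3 ^ k))\<^sup>2 - 1"
  "root_part (unit3 ^ (2 * k)) = 2 * rat_part (unit3 ^ k) * root_part (unit3 ^ k)"
proof -
  have double: "unit3 ^ (2 * k) = unit3 ^ k * unit3 ^ k"
    by (simp only: mult_2 power_add)
  show "rat_part (unit3 ^ (2 * k)) = 2 * (rat_part (unit3 ^ k))\<^sup>2 - 1"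
    using norm_unit3_power[of k]
    unfolding double times_zsqrt3.sel power2_eq_square mult.assoc by linarith
  show "root_part (unit3 ^ (2 * k)) = 2 * rat_part (unit3 ^ k) * root_part (unit3 ^ k)"
    unfolding double times_zsqrt3.sel by (simp only: mult_2 distrib_right mult.commute[of "root_part _"])
qed

text \<open>Writing \<open>a\<close> and \<open>b\<close> for the parts of \<open>unit3 ^ k\<close>,
  doubling gives \<open>unit3 ^ (2 * k) + 1\<close> the parts \<open>2 * a\<^sup>2\<close> and
  \<open>2 * a * b\<close>.\<close>

lemma dvd_unit3_double_power_plus_1:
  assumes "c dvd rat_part (unit3 ^ k)"
  shows "of_int c dvd unit3 ^ (2 * k) + 1"
  using assms by (simp add: of_int_dvd_zsqrt3_iff parts_unit3_power_double power2_eq_square)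

lemma prime_dvd_rat_part_unit3_power:
  assumes "prime c" "odd c" "of_int c dvd unit3 ^ (2 * k) + 1"
  shows "c dvd rat_part (unit3 ^ k)"
proof -
  have "c dvd 2 * (rat_part (unit3 ^ k))\<^sup>2"
    using assms(3) by (simp add: of_int_dvd_zsqrt3_iff parts_unit3_power_double)
  moreover have "\<not> c dvd 2"
    using assms(1,2) primes_dvd_imp_eq[of c 2] by auto
  ultimately show ?thesis
    using assms(1) by (auto simp: prime_dvd_mult_iff dest: prime_dvd_power)
qed

section \<open>The sum as a Chebyshev value\<close>

definition diff_square_prod :: "nat \<Rightarrow> 'a::comm_ring_1 \<Rightarrow> 'a" where
  "diff_square_prod j x = (\<Prod>l<j. x\<^sup>2 - (of_nat l)\<^sup>2)"

lemma diff_square_prod_0 [simp]: "diff_square_prod 0 x = 1"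
  by (simp add: diff_square_prod_def)

lemma diff_square_prod_Suc:
  "diff_square_prod (Suc j) x = diff_square_prod j x * (x\<^sup>2 - (of_nat j)\<^sup>2)"
  by (simp add: diff_square_prod_def)

text \<open>The two identities support each other in the induction; the second one is multiplied
  by \<open>x\<close> so that both are polynomial multiples of \<open>diff_square_prod j x\<close>.\<close>

lemma diff_square_prod_shifts:
  fixes x :: "'a::comm_ring_1"
  shows "diff_square_prod (Suc j) (x + 1) + diff_square_prod (Suc j) (x - 1) =
      2 * diff_square_prod (Suc j) x + (2 * of_nat j + 2) * (2 * of_nat j + 1) * diff_square_prod j x"
      (is "?A j = _")
    and "x * (diff_square_prod (Suc j) (x + 1) - diff_square_prod (Suc j) (x - 1)) =
      2 * (of_nat j + 1) * (2 * x\<^sup>2 + of_nat j) * diff_square_prod j x"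
      (is "?B j = _")
proof (induction j)
  case 0
  show "?A 0 = 2 * diff_square_prod (Suc 0) x + (2 * of_nat 0 + 2) * (2 * of_nat 0 + 1) * diff_square_prod 0 x"
    and "?B 0 = 2 * (of_nat 0 + 1) * (2 * x\<^sup>2 + of_nat 0) * diff_square_prod 0 x"
    by (simp_all add: diff_square_prod_Suc power2_eq_square algebra_simps)
next
  case (Suc j)
  define t where "t = (of_nat j :: 'a)"
  define d where "d = diff_square_prod j x"
  define e where "e = diff_square_prod (Suc j) (x + 1)"
  define f where "f = diff_square_prod (Suc j) (x - 1)"
  have A: "e + f = 2 * d * (x\<^sup>2 - t\<^sup>2) + (2 * t + 2) * (2 * t + 1) * d"
    and B: "x * (e - f) = 2 * (t + 1) * (2 * x\<^sup>2 + t) * d"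
    using Suc by (simp_all add: e_def f_def t_def d_def diff_square_prod_Suc[of j x])
  have 1: "diff_square_prod (Suc j) x = d * (x\<^sup>2 - t\<^sup>2)"
    by (simp add: diff_square_prod_Suc d_def t_def)
  have 2: "diff_square_prod (Suc (Suc j)) x = d * (x\<^sup>2 - t\<^sup>2) * (x\<^sup>2 - (t + 1)\<^sup>2)"
    by (simp only: diff_square_prod_Suc d_def t_def) (simp add: add.commute)
  have 3: "diff_square_prod (Suc (Suc j)) (x + 1) = e * (x\<^sup>2 + 1 - (t + 1)\<^sup>2 + 2 * x)"
    unfolding diff_square_prod_Suc[of "Suc j"] e_def[symmetric] t_def
    by (simp add: power2_eq_square algebra_simps)
  have 4: "diff_square_prod (Suc (Suc j)) (x - 1) = f * (x\<^sup>2 + 1 - (t + 1)\<^sup>2 - 2 * x)"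
    unfolding diff_square_prod_Suc[of "Suc j"] f_def[symmetric] t_def
    by (simp add: power2_eq_square algebra_simps)
  have 5: "of_nat (Suc j) = t + 1"
    by (simp add: t_def)
  show "?A (Suc j) = 2 * diff_square_prod (Suc (Suc j)) x +
      (2 * of_nat (Suc j) + 2) * (2 * of_nat (Suc j) + 1) * diff_square_prod (Suc j) x"
  proof -
    \<comment> \<open>Only the combinations \<open>e + f\<close> and \<open>x * (e - f)\<close>
      occur, and these are what \<open>A\<close> and \<open>B\<close> evaluate.\<close>
    have "?A (Suc j) = (x\<^sup>2 + 1 - (t + 1)\<^sup>2) * (e + f) + 2 * (x * (e - f))"
      unfolding 3 4 by (simp add: algebra_simps)
    then show ?thesis
      unfolding A B 1 2 5 by (simp add: power2_eq_square algebra_simps)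
  qed
  show "?B (Suc j) = 2 * (of_nat (Suc j) + 1) * (2 * x\<^sup>2 + of_nat (Suc j)) * diff_square_prod (Suc j) x"
  proof -
    have "?B (Suc j) = (x\<^sup>2 + 1 - (t + 1)\<^sup>2) * (x * (e - f)) + 2 * x\<^sup>2 * (e + f)"
      unfolding 3 4 by (simp add: power2_eq_square algebra_simps)
    then show ?thesis
      unfolding A B 1 5 by (simp add: power2_eq_square algebra_simps)
  qed
qed

lemma diff_square_prod_eq_0:
  assumes "m < j"
  shows "diff_square_prod j (of_nat m) = 0"
  using assms by (auto simp: diff_square_prod_def intro!: prod_zero)

text \<open>This is the value of the Chebyshev polynomial of degree \<open>m\<close> at
  \<open>1 + y / 2\<close>, expanded about 1.\<close>

definition cheb_sum :: "'a::field_char_0 \<Rightarrow> nat \<Rightarrow> 'a" where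
  "cheb_sum y m = (\<Sum>j\<le>m. diff_square_prod j (of_nat m) / fact (2 * j) * y ^ j)"

text \<open>Terms beyond \<open>m\<close> contain the factor with \<open>l = m\<close> and vanish,
  so values for different \<open>m\<close> can be compared over one range of summation.\<close>

lemma cheb_sum_extend:
  assumes "m \<le> N"
  shows "cheb_sum y m = (\<Sum>j\<le>N. diff_square_prod j (of_nat m) / fact (2 * j) * y ^ j)"
  unfolding cheb_sum_def
  by (rule sum.mono_neutral_left) (use assms in \<open>auto simp: diff_square_prod_eq_0\<close>)

lemma cheb_sum_recurrence:
  "cheb_sum y (Suc (Suc m)) = (2 + y) * cheb_sum y (Suc m) - cheb_sum y m"
proof -
  define x :: 'a where "x = of_nat (Suc m)"
  define c :: "nat \<Rightarrow> 'a \<Rightarrow> 'a" where "c j z = diff_square_prod j z / fact (2 * j)" for j z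
  \<comment> \<open>The central second difference in the degree lowers the index by one; summed
    against \<open>y ^ j\<close>, this becomes multiplication by \<open>y\<close>.\<close>
  have step: "c (Suc j) (x + 1) + c (Suc j) (x - 1) - 2 * c (Suc j) x = c j x" for j
  proof -
    have nz: "2 * of_nat j + (2::'a) \<noteq> 0" "2 * of_nat j + (1::'a) \<noteq> 0"
      using of_nat_eq_0_iff[of "2 * j + 2", where 'a = 'a] of_nat_eq_0_iff[of "2 * j + 1", where 'a = 'a]
      by (simp_all add: add.commute)
    have f: "fact (2 * Suc j) = (2 * of_nat j + 2) * (2 * of_nat j + 1) * (fact (2 * j) :: 'a)"
      by (simp add: algebra_simps)
    have "c (Suc j) (x + 1) + c (Suc j) (x - 1) - 2 * c (Suc j) x =
        (diff_square_prod (Suc j) (x + 1) + diff_square_prod (Suc j) (x - 1)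
          - 2 * diff_square_prod (Suc j) x) / fact (2 * Suc j)"
      by (simp add: c_def diff_divide_distrib add_divide_distrib)
    also have "\<dots> = c j x"
      unfolding diff_square_prod_shifts(1) f c_def using nz by simp
    finally show ?thesis .
  qed
  have S: "cheb_sum y k = (\<Sum>j\<le>Suc (Suc m). c j (of_nat k) * y ^ j)" if "k \<le> Suc (Suc m)" for k
    using that by (simp add: cheb_sum_extend[of k "Suc (Suc m)"] c_def)
  have x1: "of_nat (Suc (Suc m)) = x + 1" and x2: "of_nat m = x - 1"
    by (simp_all add: x_def)
  have "cheb_sum y (Suc (Suc m)) + cheb_sum y m - 2 * cheb_sum y (Suc m) =
      (\<Sum>j\<le>Suc (Suc m). (c j (x + 1) + c j (x - 1) - 2 * c j x) * y ^ j)"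
    by (simp only: S le_refl le_SucI x1 x2 x_def[symmetric] sum_distrib_left
          sum.distrib[symmetric] sum_subtractf[symmetric]) (simp add: algebra_simps)
  \<comment> \<open>The term at index 0 drops out because \<open>c 0\<close> is constantly
    1.\<close>
  also have "\<dots> = (\<Sum>j\<le>Suc m. c j x * y ^ Suc j)"
    unfolding sum.atMost_Suc_shift[of _ "Suc m"] step by (simp add: c_def)
  also have "\<dots> = y * cheb_sum y (Suc m)"
    by (simp add: cheb_sum_def c_def x_def sum_distrib_left algebra_simps)
  finally show ?thesis
    by (simp add: algebra_simps)
qed

text \<open>The element \<open>- (unit3\<^sup>2)\<close> has rational part -7 and norm 1, so its
  powers obey the recurrence with \<open>2 + y = - 14\<close>.\<close>

lemma cheb_sum_minus_16: "cheb_sum (- 16) m = of_int (rat_part ((- (unit3\<^sup>2)) ^ m))"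
proof (induction m rule: induct_nat_012)
  case (ge2 m)
  define u where "u = - (unit3\<^sup>2)"
  have "u ^ 2 = - 14 * u - 1"
    by (rule zsqrt3_eqI) (simp_all add: u_def power2_eq_square)
  then have "u\<^sup>2 * u ^ m = - 14 * u ^ Suc m - u ^ m"
    by (simp only: left_diff_distrib power_Suc mult.assoc mult_1)
  then have "u ^ Suc (Suc m) = - 14 * u ^ Suc m - u ^ m"
    by (simp add: power2_eq_square mult.assoc)
  then show ?case
    using ge2 by (simp add: cheb_sum_recurrence u_def[symmetric])
qed (simp_all add: cheb_sum_def diff_square_prod_def power2_eq_square)

lemma sum_eq_cheb_sum:
  "(\<Sum>k \<in> {k \<in> {0..4 * m div 2}. even k}.
      (- 1) ^ (k div 2) *
        ((\<Prod>l = 0..<k div 2. (of_nat (4 * m))\<^sup>2 - (4 * of_nat l)\<^sup>2) / fact k)) =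
    (cheb_sum (- 16) m :: 'a::field_char_0)"
proof -
  have "{k \<in> {0..4 * m div 2}. even k} = (\<lambda>j. 2 * j) ` {..m}"
    by (auto elim!: evenE)
  moreover have "(- 1) ^ j * ((\<Prod>l = 0..<j. (of_nat (4 * m))\<^sup>2 - (4 * of_nat l)\<^sup>2) / fact (2 * j)) =
      diff_square_prod j (of_nat m) / fact (2 * j) * (- 16 :: 'a) ^ j" for j
  proof -
    have "(\<Prod>l = 0..<j. (of_nat (4 * m))\<^sup>2 - (4 * of_nat l :: 'a)\<^sup>2) =
        (\<Prod>l<j. 16 * ((of_nat m)\<^sup>2 - (of_nat l)\<^sup>2))"
      by (intro prod.cong) (auto simp: power2_eq_square algebra_simps)
    also have "\<dots> = 16 ^ j * diff_square_prod j (of_nat m)"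
      by (simp add: prod.distrib diff_square_prod_def del: right_diff_distrib_numeral)
    finally show ?thesis
      by (simp add: power_minus[of 16])
  qed
  ultimately show ?thesis
    by (simp add: cheb_sum_def sum.reindex inj_on_def)
qed

section \<open>The Lucas--Lehmer criterion\<close>

lemma unit3_power_collision:
  assumes "q dvd unit3 ^ (i + d) - unit3 ^ i"
  shows "q dvd unit3 ^ d - 1"
proof -
  have "unit3 ^ i * Zsqrt3 2 (- 1) ^ i = 1"
    by (metis power_mult_distrib power_one unit3_norm)
  then have "(unit3 ^ (i + d) - unit3 ^ i) * Zsqrt3 2 (- 1) ^ i = unit3 ^ d - 1"
    by (simp add: power_add algebra_simps)
  with assms show ?thesis
    by (metis dvd_mult2)
qed

lemma exists_unit3_power_cong_1:
  assumes "q > 1" "q\<^sup>2 \<le> N"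
  shows "\<exists>d. 0 < d \<and> d < N \<and> of_nat q dvd unit3 ^ d - 1"
proof -
  define f where "f k = (rat_part (unit3 ^ k) mod int q, root_part (unit3 ^ k) mod int q)" for k
  \<comment> \<open>Norm 1 keeps the residue pair away from zero, which leaves
    \<open>q\<^sup>2 - 1\<close> values for \<open>N\<close> powers.\<close>
  have nz: "f k \<noteq> (0, 0)" for k
  proof
    assume "f k = (0, 0)"
    then have "int q dvd rat_part (unit3 ^ k)" "int q dvd root_part (unit3 ^ k)"
      by (auto simp: f_def)
    then have "int q dvd (rat_part (unit3 ^ k))\<^sup>2 - 3 * (root_part (unit3 ^ k))\<^sup>2"
      by (simp add: power2_eq_square)
    with \<open>q > 1\<close> show False
      by (simp add: norm_unit3_power)
  qed
  have "f k \<in> {0..<int q} \<times> {0..<int q}" for k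
    using \<open>q > 1\<close> by (simp add: f_def)
  with nz have "f ` {..<N} \<subseteq> {0..<int q} \<times> {0..<int q} - {(0, 0)}"
    by (intro image_subsetI) simp
  then have "card (f ` {..<N}) \<le> card ({0..<int q} \<times> {0..<int q} - {(0, 0)})"
    by (intro card_mono) auto
  also have "\<dots> = q\<^sup>2 - 1"
    using \<open>q > 1\<close> by (subst card_Diff_subset) (auto simp: card_cartesian_product power2_eq_square)
  also have "\<dots> < card {..<N}"
  proof -
    have "q\<^sup>2 > 0"
      using \<open>q > 1\<close> by simp
    with \<open>q\<^sup>2 \<le> N\<close> show ?thesis
      unfolding card_lessThan by linarith
  qed
  finally have "\<not> inj_on f {..<N}"
    by (rule pigeonhole)
  then obtain i j where ij: "i < j" "j < N" "f j = f i"
    unfolding inj_on_def by (metis lessThan_iff linorder_neqE_nat)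
  have "of_int (int q) dvd unit3 ^ (i + (j - i)) - unit3 ^ i"
    unfolding of_int_dvd_zsqrt3_iff using ij by (simp add: f_def mod_eq_dvd_iff)
  then have "of_nat q dvd unit3 ^ (j - i) - 1"
    by (intro unit3_power_collision) simp
  with ij show ?thesis
    by (intro exI[of _ "j - i"]) auto
qed

text \<open>Write \<open>d = 2 ^ e * r\<close> with \<open>r\<close> odd and
  \<open>e \<le> k\<close>. If \<open>unit3 ^ d\<close> were 1 modulo \<open>q\<close>, raising it
  to the power \<open>2 ^ (k - e)\<close> would give 1, but the result is also
  \<open>(- 1) ^ r = - 1\<close>; hence \<open>q\<close> would divide 2.\<close>

lemma not_dvd_unit3_power_minus_1:
  assumes q: "odd q" "q > (1::nat)"
    and dvd: "of_nat q dvd unit3 ^ (2 ^ k) + 1"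
    and d: "0 < d" "d < 2 ^ Suc k"
  shows "\<not> of_nat q dvd unit3 ^ d - 1"
proof
  assume *: "of_nat q dvd unit3 ^ d - 1"
  define e where "e = multiplicity 2 d"
  obtain r where r: "d = 2 ^ e * r" "odd r"
    unfolding e_def
    by (rule multiplicity_decompose'[where x = d and p = 2]) (use d(1) in auto)
  have "(2::nat) ^ e \<le> d"
    using d(1) by (simp add: e_def dvd_imp_le multiplicity_dvd)
  with d(2) have "(2::nat) ^ e < 2 ^ Suc k"
    by linarith
  then have "e \<le> k"
    using power_less_imp_less_exp[of "2::nat" e "Suc k"] by simp
  then have "(2::nat) ^ k = 2 ^ e * 2 ^ (k - e)"
    by (simp flip: power_add)
  with r(1) have "d * 2 ^ (k - e) = 2 ^ k * r"
    by (metis mult.assoc mult.commute)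
  then have "(unit3 ^ d) ^ (2 ^ (k - e)) = (unit3 ^ (2 ^ k)) ^ r"
    by (metis power_mult)
  then have "unit3 ^ d - 1 dvd (unit3 ^ (2 ^ k)) ^ r - 1"
    using power_diff_1_eq[of "unit3 ^ d" "2 ^ (k - e)"] by simp
  with * have 1: "of_nat q dvd (unit3 ^ (2 ^ k)) ^ r - 1"
    by (rule dvd_trans)
  \<comment> \<open>For odd \<open>r\<close>, this is the factorization of a difference of
    \<open>r\<close>-th powers with second base -1.\<close>
  have "unit3 ^ (2 ^ k) + 1 dvd (unit3 ^ (2 ^ k)) ^ r + 1"
    using diff_power_eq_sum[of "unit3 ^ (2 ^ k)" "r - 1" "- 1"] r(2) by (cases r) auto
  with dvd have 2: "of_nat q dvd (unit3 ^ (2 ^ k)) ^ r + 1"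
    by (rule dvd_trans)
  have "of_int (int q) dvd (2 :: zsqrt3)"
    using dvd_diff[OF 2 1] by simp
  then have "int q dvd 2"
    by (simp only: of_int_dvd_zsqrt3_iff parts_numeral)
  then have "q dvd 2"
    by (metis int_dvd_int_iff of_nat_numeral)
  with q show False
    by (metis One_nat_def dvd_refl less_irrefl prime_nat_iff two_is_prime_nat)
qed

lemma exists_prime_factor_le_sqrt:
  assumes "n > (1::nat)" "\<not> prime n"
  shows "\<exists>q. prime q \<and> q dvd n \<and> q\<^sup>2 \<le> n"
proof -
  obtain a b where ab: "n = a * b" "1 < a" "a \<le> b"
  proof -
    obtain c where c: "c dvd n" "c \<noteq> 1" "c \<noteq> n"
      using assms by (auto simp: prime_nat_iff)
    then obtain b where "n = c * b" by blast
    with c assms that[of c b] that[of b c] show ?thesis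
      by (cases "c \<le> b"; cases c; cases b) auto
  qed
  obtain q where q: "prime q" "q dvd a"
    using ab(2) prime_factor_nat[of a] by auto
  then have "q \<le> a"
    using ab(2) by (auto intro: dvd_imp_le)
  then have "q\<^sup>2 \<le> n"
    using ab by (auto simp: power2_eq_square intro: mult_le_mono)
  with q ab show ?thesis by auto
qed

text \<open>A composite number would have a prime factor \<open>q\<close> with
  \<open>q\<^sup>2 < 2 ^ p\<close>; the pigeonhole bound then yields an exponent below
  \<open>2 ^ p\<close> that the order argument excludes.\<close>

lemma mersenne_prime_if_dvd_unit3_power:
  assumes "p \<ge> 2" and dvd: "int (2 ^ p - 1) dvd rat_part (unit3 ^ (2 ^ (p - 2)))"
  shows "prime ((2::nat) ^ p - 1)"
proof (rule ccontr)
  assume "\<not> prime ((2::nat) ^ p - 1)"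
  moreover have "(2::nat) ^ 2 \<le> 2 ^ p"
    using assms(1) by (rule power_increasing) simp
  ultimately obtain q :: nat where q: "prime q" "q dvd 2 ^ p - 1" "q\<^sup>2 \<le> 2 ^ p - 1"
    using exists_prime_factor_le_sqrt[of "2 ^ p - 1"] by fastforce
  have "odd ((2::nat) ^ p - 1)"
    using assms(1) by simp
  then have "odd q"
    using q(2) dvd_trans by blast
  have "int q dvd rat_part (unit3 ^ (2 ^ (p - 2)))"
    using q(2) dvd by (meson dvd_trans int_dvd_int_iff)
  moreover have "2 * 2 ^ (p - 2) = (2::nat) ^ (p - 1)"
    using assms(1) by (simp flip: power_Suc add: Suc_diff_le)
  ultimately have "of_int (int q) dvd unit3 ^ (2 ^ (p - 1)) + 1"
    using dvd_unit3_double_power_plus_1 by metis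
  then have "\<not> of_nat q dvd unit3 ^ d - 1" if "0 < d" "d < 2 ^ p" for d
    using that assms(1) not_dvd_unit3_power_minus_1[of q "p - 1" d] \<open>odd q\<close> prime_gt_1_nat[OF q(1)]
    by simp
  moreover have "q\<^sup>2 \<le> 2 ^ p"
    using q(3) by linarith
  ultimately show False
    using exists_unit3_power_cong_1[of q "2 ^ p"] prime_gt_1_nat[OF q(1)] by blast
qed

section \<open>Necessity: the Frobenius map and residues modulo a Mersenne prime\<close>

lemma prime_dvd_power_add_diff:
  fixes x y :: "'a::comm_ring_1"
  assumes "prime q"
  shows "of_nat q dvd (x + y) ^ q - (x ^ q + y ^ q)"
proof -
  define g where "g k = of_nat (q choose k) * x ^ k * y ^ (q - k)" for k
  have "q > 0"
    using assms prime_gt_0_nat by blast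
  then have "{..q} = insert 0 (insert q {1..<q})"
    by auto
  then have "(x + y) ^ q - (x ^ q + y ^ q) = (\<Sum>k\<in>{1..<q}. g k)"
    using \<open>q > 0\<close> by (simp add: binomial_ring g_def)
  moreover have "of_nat q dvd g k" if "k \<in> {1..<q}" for k
  proof -
    have "q dvd q choose k"
      using that assms by (intro dvd_choose_prime) auto
    then have "of_nat q dvd (of_nat (q choose k) :: 'a)"
      by (auto elim!: dvdE)
    then show ?thesis
      by (simp add: g_def)
  qed
  ultimately show ?thesis
    by (metis dvd_sum)
qed

text \<open>The modulus is 1 modulo 3 and 3 modulo 4, so reciprocity makes 3 a non-residue; Euler's
  criterion turns this into the power congruence.\<close>

lemma mersenne_3_power_cong:
  assumes "prime ((2::nat) ^ p - 1)" "odd p" "p \<ge> 3"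
  shows "[3 ^ (2 ^ (p - 1) - 1) = - 1] (mod int (2 ^ p - 1))"
proof -
  define M :: nat where "M = 2 ^ p - 1"
  have p: "(2::nat) ^ p = 2 * 2 ^ (p - 1)"
    using assms(3) by (cases p) auto
  have "(2::nat) ^ 3 \<le> 2 ^ p"
    using assms(3) by (rule power_increasing) simp
  then have M: "M \<ge> 7"
    by (simp add: M_def)
  have half: "(M - 1) div 2 = 2 ^ (p - 1) - 1"
    unfolding M_def p by simp
  have "[int M = 1] (mod 3)"
  proof -
    obtain k where k: "p = Suc (2 * k)"
      using assms(2) by (auto elim!: oddE)
    have "[(4::int) ^ k = 1 ^ k] (mod 3)"
      by (rule cong_pow) (simp add: cong_def)
    then have "[2 * 4 ^ k - 1 = 2 * 1 ^ k - (1::int)] (mod 3)"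
      by (intro cong_diff cong_mult) auto
    moreover have "int M = 2 * 4 ^ k - 1"
      by (simp add: M_def k of_nat_diff power_mult)
    ultimately show ?thesis
      by simp
  qed
  moreover from this have "\<not> [int M = 0] (mod 3)"
    by (auto simp: cong_def)
  moreover from calculation have "QuadRes 3 (int M)"
    unfolding QuadRes_def by (metis cong_sym power_one)
  ultimately have "Legendre (int M) 3 = 1"
    by (simp add: Legendre_def)
  moreover have "Legendre (int 3) (int M) * Legendre (int M) (int 3) =
      (- 1) ^ ((3 - 1) div 2 * ((M - 1) div 2))"
    using assms(1) M by (intro Quadratic_Reciprocity) (auto simp: M_def)
  \<comment> \<open>This is half of \<open>M - 1\<close>; its oddness fixes the sign in the
    reciprocity law.\<close>
  moreover have "odd ((2::nat) ^ (p - 1) - 1)"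
    using assms(3) by simp
  ultimately have "Legendre 3 (int M) = - 1"
    unfolding half by simp
  moreover have "[Legendre 3 (int M) = 3 ^ ((M - 1) div 2)] (mod int M)"
    using assms(1) M by (intro euler_criterion) (auto simp: M_def)
  ultimately show ?thesis
    by (metis M_def cong_sym half)
qed

text \<open>Modulo \<open>2 ^ p - 1\<close> the power \<open>2 ^ p\<close> is 1, and by Fermat's
  theorem \<open>p\<close> divides the exponent.\<close>

lemma mersenne_2_power_cong:
  assumes "prime p" "odd p"
  shows "[2 ^ (2 ^ (p - 1) - 1) = 1] (mod int (2 ^ p - 1))"
proof -
  have "\<not> p dvd 2"
    using assms primes_dvd_imp_eq[of p 2] by auto
  with assms(1) have "[2 ^ (p - 1) = 1] (mod p)"
    by (rule fermat_theorem)
  then have "p dvd 2 ^ (p - 1) - 1"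
    using cong_altdef_nat[of 1 "2 ^ (p - 1)" p] by (simp add: cong_sym_eq)
  then obtain k where k: "2 ^ (p - 1) - 1 = p * k"
    by blast
  have "[(2 ^ p) ^ k = 1 ^ k] (mod int (2 ^ p - 1))"
    by (intro cong_pow) (simp add: cong_iff_dvd_diff of_nat_diff)
  then show ?thesis
    unfolding k by (simp add: power_mult)
qed

text \<open>Here \<open>(1 + root3)\<^sup>2 = 2 * unit3\<close>, and modulo a Mersenne prime the Frobenius map sends
  \<open>1 + root3\<close> to \<open>1 - root3\<close>, because 3 is a quadratic non-residue.\<close>

lemma mersenne_prime_dvd_unit3_power:
  assumes "prime p" "odd p" "p \<ge> 3" and prime: "prime ((2::nat) ^ p - 1)"
  shows "int (2 ^ p - 1) dvd rat_part (unit3 ^ (2 ^ (p - 2)))"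
proof -
  define M :: nat where "M = 2 ^ p - 1"
  define h :: nat where "h = 2 ^ (p - 1) - 1"
  have p: "(2::nat) ^ p = 2 * 2 ^ (p - 1)" "(2::nat) ^ (p - 1) = 2 * 2 ^ (p - 2)"
    using assms(3) by (simp_all flip: power_Suc add: Suc_diff_le)
  have h: "Suc h = 2 ^ (p - 1)"
    by (simp add: h_def)
  have M: "M = 2 * h + 1"
    unfolding M_def p(1) h[symmetric] by simp
  have "odd M" by (simp add: M)
  have dvd_of_int: "of_nat M dvd (of_int a :: zsqrt3)" if "int M dvd a" for a
    using that by (auto elim!: dvdE)
  define s where "s = 1 + root3"
  have root3_M: "root3 ^ M = 3 ^ h * root3"
    by (simp add: M power_mult root3_square)
  have "of_nat M dvd s ^ M - (1 + root3 ^ M)"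
    using prime_dvd_power_add_diff[of M 1 root3] prime by (simp add: s_def M_def)
  moreover have "of_nat M dvd (3 ^ h + 1 :: zsqrt3)"
    using dvd_of_int[of "3 ^ h + 1"] mersenne_3_power_cong[OF prime assms(2,3)]
    by (simp add: cong_iff_dvd_diff M_def h_def)
  ultimately have "of_nat M dvd (s ^ M - (1 + root3 ^ M)) + (3 ^ h + 1) * root3"
    by (intro dvd_add) auto
  \<comment> \<open>The factor \<open>s\<close> raises the exponent to
    \<open>M + 1 = 2 * Suc h\<close>, so that \<open>s\<^sup>2\<close> can be replaced, and turns
    \<open>1 - root3\<close> into the norm -2.\<close>
  then have "of_nat M dvd (s ^ M - (1 - root3)) * s"
    unfolding root3_M by (intro dvd_mult2) (simp add: algebra_simps)
  also have "(s ^ M - (1 - root3)) * s = (s\<^sup>2) ^ Suc h - (1 - root3) * s"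
    unfolding power_mult[symmetric] M by (simp add: algebra_simps)
  also have "s\<^sup>2 = 2 * unit3"
    by (rule zsqrt3_eqI) (simp_all add: s_def power2_eq_square)
  also have "(1 - root3) * s = - 2"
    by (rule zsqrt3_eqI) (simp_all add: s_def)
  finally have "of_int (int M) dvd 2 * (2 ^ h * unit3 ^ Suc h + 1)"
    by (simp add: power_mult_distrib algebra_simps)
  moreover have "of_int (int M) dvd z" if "of_int (int M) dvd 2 * z" for z :: zsqrt3
    using that \<open>odd M\<close> unfolding of_int_dvd_zsqrt3_iff
    by (simp add: coprime_dvd_mult_right_iff)
  ultimately have "of_int (int M) dvd 2 ^ h * unit3 ^ Suc h + 1"
    by blast
  then have "of_nat M dvd 2 ^ h * unit3 ^ Suc h + 1"
    by simp
  moreover have "of_nat M dvd (2 ^ h - 1 :: zsqrt3)"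
    using dvd_of_int[of "2 ^ h - 1"] mersenne_2_power_cong[OF assms(1,2)]
    by (simp add: cong_iff_dvd_diff M_def h_def)
  \<comment> \<open>Since \<open>2 ^ h\<close> is 1 modulo \<open>M\<close>, it can be removed from
    the product.\<close>
  ultimately have "of_nat M dvd (2 ^ h * unit3 ^ Suc h + 1) - (2 ^ h - 1) * unit3 ^ Suc h"
    by (rule dvd_diff[OF _ dvd_mult2])
  also have "(2 ^ h * unit3 ^ Suc h + 1) - (2 ^ h - 1) * unit3 ^ Suc h = unit3 ^ Suc h + 1"
    by (simp only: left_diff_distrib mult_1) simp
  finally have "of_int (int M) dvd unit3 ^ (2 * 2 ^ (p - 2)) + 1"
    unfolding h p(2) by simp
  moreover have "prime (int M)"
    using prime unfolding M_def prime_nat_int_transfer .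
  ultimately have "int M dvd rat_part (unit3 ^ (2 ^ (p - 2)))"
    using \<open>odd M\<close> by (intro prime_dvd_rat_part_unit3_power) simp_all
  then show ?thesis
    unfolding M_def .
qed

theorem theorem4:
  fixes p n :: nat
  assumes "prime p" and "p \<ge> 5" and "n = 2 ^ (p - 1)"
  shows "prime ((2::nat) ^ p - 1) \<longleftrightarrow>
    (\<exists>s::int.
      of_int s = (\<Sum>k \<in> {k \<in> {0..n div 2}. even k}.
        (- 1) ^ (k div 2) *
          ((\<Prod>l = 0..<k div 2. (of_nat n)\<^sup>2 - (4 * of_nat l)\<^sup>2) / fact k) :: rat) \<and>
      (2 * int n - 1) dvd s)"
proof -
  define m :: nat where "m = 2 ^ (p - 3)"
  obtain r where r: "p = r + 5"
    using assms(2) by (metis add.commute le_Suc_ex)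
  have n: "n = 4 * m" and "even m" and m: "2 * m = 2 ^ (p - 2)"
    by (simp_all add: assms(3) m_def r power_add)
  have "(- (unit3\<^sup>2)) ^ m = unit3 ^ (2 ^ (p - 2))"
    using \<open>even m\<close> by (simp flip: m add: power_mult)
  then have "(\<Sum>k \<in> {k \<in> {0..n div 2}. even k}.
        (- 1) ^ (k div 2) *
          ((\<Prod>l = 0..<k div 2. (of_nat n)\<^sup>2 - (4 * of_nat l)\<^sup>2) / fact k) :: rat) =
      of_int (rat_part (unit3 ^ (2 ^ (p - 2))))"
    unfolding n sum_eq_cheb_sum cheb_sum_minus_16 by simp
  moreover have "2 * int n - 1 = int (2 ^ p - 1)"
    by (simp add: assms(3) r power_add)
  moreover have "odd p"
    using assms(1,2) prime_odd_nat by auto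
  then have "prime ((2::nat) ^ p - 1) \<longleftrightarrow> int (2 ^ p - 1) dvd rat_part (unit3 ^ (2 ^ (p - 2)))"
    using mersenne_prime_dvd_unit3_power mersenne_prime_if_dvd_unit3_power assms(1,2) by auto
  ultimately show ?thesis
    by simp
qed

end
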